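(* Let $s\in\mathbb{Z}_{\ge1}$ and let $\widetilde{\mathcal{T}}_m^a(u)$ be the normalized functions associated with $B(0|s)$ and the rectangular Young diagram with $a$ rows and $m$ columns, as defined in the context. Then for every $a\in\mathbb{Z}_{\ge1}$ and every $m\in\{0,1,\dots,2s+1\}$, $$\widetilde{\mathcal{T}}_m^a(u)=\widetilde{\mathcal{T}}_{2s-m+1}^a(u).$$
   Context: $\Phi$ is an entire function, not identically zero, with a zero at $u=0$ (e.g. $\Phi(u)=u$); $N,N_a\in\mathbb{Z}_{\ge0}$; $w_j,u_j^{(a)}\in\mathbb{C}$ are parameters; $Q_a(u)=\prod_{j=1}^{N_a}\Phi(u-u_j^{(a)})$ for $1\le a\le s$; $Q_0(u)=1$; $\phi(u)=\prod_{j=1}^N\Phi(u-w_j)$. Identities are between meromorphic functions of $u$. **Index set.** $J=\{1,\dots,s,0,\overline s,\dots,\overline1\}$ with total order $1\prec\cdots\prec s\prec0\prec\overline s\prec\cdots\prec\overline1$; $p(0)=0$ and $p(c)=1$ for $c\ne0$. **Box functions.** - $1\le a\le s$: $[a]_u=\psi_a(u)\frac{Q_{a-1}(u-a-1)Q_a(u-a+2)}{Q_{a-1}(u-a+1)Q_a(u-a)}$. - $[0]_u=\psi_0(u)\frac{Q_s(u-s+1)Q_s(u-s-2)}{Q_s(u-s-1)Q_s(u-s)}$. - $1\le a\le s$: $[\overline a]_u=\psi_{\overline a}(u)\frac{Q_{a-1}(u-2s+a)Q_a(u-2s+a-3)}{Q_{a-1}(u-2s+a-2)Q_a(u-2s+a-1)}$.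 Here $\psi_1(u)=\phi(u-2)\phi(u-2s-1)$, $\psi_{\overline1}(u)=\phi(u)\phi(u-2s+1)$, and $\psi_c(u)=\phi(u)\phi(u-2s-1)$ for all other $c\in J$. **Rectangular functions.** For $m,a\ge1$, $$\mathcal{T}_m^a(u)=\sum_b\ \prod_{i=1}^a\prod_{j=1}^m(-1)^{p(b(i,j))}[b(i,j)]_{u-m+a-2i+2j},$$ the sum being over fillings $b(i,j)\in J$ ($1\le i\le a$ row, $1\le j\le m$ column) with $b(i,j)\prec b(i,j+1)$ and $b(i,j)\preceq b(i+1,j)$; $\mathcal{T}_0^a(u)=1$. **Normalization.** $\widetilde{\mathcal{T}}_m^a(u)=\mathcal{T}_m^a(u)\big/\prod_{j=1}^a\mathcal{F}_m(u+a-2j+1)$, where $$\mathcal{F}_m(u)=\prod_{j=1}^{m-1}\phi(u-m+2j+1)\,\phi(u-2s-m+2j-2)\quad(m\ge2),$$ $\mathcal{F}_1(u)=1$, and $\mathcal{F}_0(u)=\{\phi(u+1)\phi(u-2s-2)\}^{-1}$. In particular $\widetilde{\mathcal{T}}_0^a(u)=\prod_{j=1}^a\phi(u+a-2j+2)\phi(u+a-2j-2s-1)$. *)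

theory Defs
  imports "HOL-Complex_Analysis.Complex_Analysis"
begin

datatype letter = Plain nat | Zero | Bar nat

text \<open>
  The order 1 < ... < s < 0 < bar s < ... < bar 1; it does not depend on s once restricted to
  the index set.
\<close>

fun prec :: "letter \<Rightarrow> letter \<Rightarrow> bool" (infix \<open>\<prec>\<close> 50) where
  "Plain a \<prec> Plain b \<longleftrightarrow> a < b"
| "Plain a \<prec> Zero \<longleftrightarrow> True"
| "Plain a \<prec> Bar b \<longleftrightarrow> True"
| "Zero \<prec> Plain b \<longleftrightarrow> False"
| "Zero \<prec> Zero \<longleftrightarrow> False"
| "Zero \<prec> Bar b \<longleftrightarrow> True"
| "Bar a \<prec> Plain b \<longleftrightarrow> False"
| "Bar a \<prec> Zero \<longleftrightarrow> False"
| "Bar a \<prec> Bar b \<longleftrightarrow> b < a"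

definition preceq :: "letter \<Rightarrow> letter \<Rightarrow> bool" (infix \<open>\<preceq>\<close> 50) where
  "c \<preceq> d \<longleftrightarrow> c \<prec> d \<or> c = d"

definition letters :: "nat \<Rightarrow> letter set" where
  "letters s = Plain ` {1..s} \<union> {Zero} \<union> Bar ` {1..s}"

fun parity :: "letter \<Rightarrow> nat" where
  "parity Zero = 0"
| "parity (Plain a) = 1"
| "parity (Bar a) = 1"

definition vac :: "(complex \<Rightarrow> complex) \<Rightarrow> nat \<Rightarrow> (nat \<Rightarrow> complex) \<Rightarrow> complex \<Rightarrow> complex" where
  "vac \<Phi> N w u = (\<Prod>j=1..N. \<Phi> (u - w j))"

definition Qfun :: "(complex \<Rightarrow> complex) \<Rightarrow> (nat \<Rightarrow> nat) \<Rightarrow> (nat \<Rightarrow> nat \<Rightarrow> complex)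
    \<Rightarrow> nat \<Rightarrow> complex \<Rightarrow> complex" where
  "Qfun \<Phi> M v a u = (if a = 0 then 1 else (\<Prod>j=1..M a. \<Phi> (u - v a j)))"

text \<open>The vacuum factor, as a function of the letter; here \<open>\<phi>\<close> is meant to be \<open>vac \<Phi> N w\<close>.\<close>

definition psi :: "(complex \<Rightarrow> complex) \<Rightarrow> nat \<Rightarrow> letter \<Rightarrow> complex \<Rightarrow> complex" where
  "psi \<phi> s c u =
     (if c = Plain 1 then \<phi> (u - 2) * \<phi> (u - 2 * of_nat s - 1)
      else if c = Bar 1 then \<phi> u * \<phi> (u - 2 * of_nat s + 1)
      else \<phi> u * \<phi> (u - 2 * of_nat s - 1))"

text \<open>The box functions; \<open>Q a\<close> is meant to be \<open>Qfun \<Phi> M v a\<close>.\<close>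

fun boxfn :: "(complex \<Rightarrow> complex) \<Rightarrow> (nat \<Rightarrow> complex \<Rightarrow> complex) \<Rightarrow> nat
    \<Rightarrow> letter \<Rightarrow> complex \<Rightarrow> complex" where
  "boxfn \<phi> Q s (Plain a) u =
     psi \<phi> s (Plain a) u *
       (Q (a - 1) (u - of_nat a - 1) * Q a (u - of_nat a + 2)) /
       (Q (a - 1) (u - of_nat a + 1) * Q a (u - of_nat a))"
| "boxfn \<phi> Q s Zero u =
     psi \<phi> s Zero u *
       (Q s (u - of_nat s + 1) * Q s (u - of_nat s - 2)) /
       (Q s (u - of_nat s - 1) * Q s (u - of_nat s))"
| "boxfn \<phi> Q s (Bar a) u =
     psi \<phi> s (Bar a) u *
       (Q (a - 1) (u - 2 * of_nat s + of_nat a) * Q a (u - 2 * of_nat s + of_nat a - 3)) /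
       (Q (a - 1) (u - 2 * of_nat s + of_nat a - 2) * Q a (u - 2 * of_nat s + of_nat a - 1))"

text \<open>
  Fillings of the rectangle with a rows and m columns. They are extensional functions, so that
  each filling is counted once; there is exactly one filling when m = 0.
\<close>

definition tableaux :: "nat \<Rightarrow> nat \<Rightarrow> nat \<Rightarrow> (nat \<times> nat \<Rightarrow> letter) set" where
  "tableaux s a m =
     {b \<in> ({1..a} \<times> {1..m}) \<rightarrow>\<^sub>E letters s.
        (\<forall>i\<in>{1..a}. \<forall>j\<in>{1..<m}. b (i, j) \<prec> b (i, j + 1)) \<and>
        (\<forall>i\<in>{1..<a}. \<forall>j\<in>{1..m}. b (i, j) \<preceq> b (i + 1, j))}"

definition Trect :: "(complex \<Rightarrow> complex) \<Rightarrow> (nat \<Rightarrow> complex \<Rightarrow> complex) \<Rightarrow> nat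
    \<Rightarrow> nat \<Rightarrow> nat \<Rightarrow> complex \<Rightarrow> complex" where
  "Trect \<phi> Q s a m u =
     (\<Sum>b\<in>tableaux s a m. \<Prod>i=1..a. \<Prod>j=1..m.
        (-1) ^ parity (b (i, j)) *
        boxfn \<phi> Q s (b (i, j)) (u - of_nat m + of_nat a - 2 * of_nat i + 2 * of_nat j))"

definition Fnorm :: "(complex \<Rightarrow> complex) \<Rightarrow> nat \<Rightarrow> nat \<Rightarrow> complex \<Rightarrow> complex" where
  "Fnorm \<phi> s m u =
     (if m = 0 then inverse (\<phi> (u + 1) * \<phi> (u - 2 * of_nat s - 2))
      else (\<Prod>j=1..m - 1. \<phi> (u - of_nat m + 2 * of_nat j + 1) *
                         \<phi> (u - 2 * of_nat s - of_nat m + 2 * of_nat j - 2)))"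

definition Ttilde :: "(complex \<Rightarrow> complex) \<Rightarrow> nat \<Rightarrow> (nat \<Rightarrow> complex)
    \<Rightarrow> (nat \<Rightarrow> nat) \<Rightarrow> (nat \<Rightarrow> nat \<Rightarrow> complex)
    \<Rightarrow> nat \<Rightarrow> nat \<Rightarrow> nat \<Rightarrow> complex \<Rightarrow> complex" where
  "Ttilde \<Phi> N w M v s a m u =
     Trect (vac \<Phi> N w) (Qfun \<Phi> M v) s a m u /
     (\<Prod>j=1..a. Fnorm (vac \<Phi> N w) s m (u + of_nat a - 2 * of_nat j + 1))"

lemma finite_tableaux: "finite (tableaux s a m)"
proof -
  have "finite (({1..a} \<times> {1..m}) \<rightarrow>\<^sub>E letters s)"
    by (intro finite_PiE) (auto simp: letters_def)
  then show ?thesis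
    unfolding tableaux_def by (rule rev_finite_subset) auto
qed

lemma Trect_0: "Trect \<phi> Q s a 0 u = 1"
proof -
  have "tableaux s a 0 = {\<lambda>_. undefined}"
    by (auto simp: tableaux_def)
  then show ?thesis by (simp add: Trect_def)
qed

lemma Ttilde_0:
  "Ttilde \<Phi> N w M v s a 0 u =
     (\<Prod>j=1..a. vac \<Phi> N w (u + of_nat a - 2 * of_nat j + 2) *
               vac \<Phi> N w (u + of_nat a - 2 * of_nat j - 2 * of_nat s - 1))"
  by (simp add: Ttilde_def Trect_0 Fnorm_def prod_inversef[symmetric] divide_inverse
        algebra_simps flip: prod.distrib)

text \<open>
  Pointwise values at poles are subject to the convention x / 0 = 0, so an identity of meromorphic
  functions on the plane is to be read as agreement on a cosparse set.
\<close>

lemma Ttilde_meromorphic: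
  assumes "\<Phi> holomorphic_on UNIV"
  shows "Ttilde \<Phi> N w M v s a m meromorphic_on UNIV"
proof -
  have hv: "vac \<Phi> N w holomorphic_on UNIV"
    unfolding vac_def
    by (intro holomorphic_intros holomorphic_on_compose_gen[OF _ assms, unfolded o_def]) auto
  have hQ: "Qfun \<Phi> M v k holomorphic_on UNIV" for k
    unfolding Qfun_def
    by (cases "k = 0")
       (auto intro!: holomorphic_intros holomorphic_on_compose_gen[OF _ assms, unfolded o_def])
  have mv: "(\<lambda>u. vac \<Phi> N w (g u)) meromorphic_on UNIV" if "g holomorphic_on UNIV" for g
    using holomorphic_on_compose_gen[OF that hv]
    by (auto intro!: analytic_on_imp_meromorphic_on simp: analytic_on_open o_def)
  have mQ: "(\<lambda>u. Qfun \<Phi> M v k (g u)) meromorphic_on UNIV" if "g holomorphic_on UNIV" for g k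
    using holomorphic_on_compose_gen[OF that hQ]
    by (auto intro!: analytic_on_imp_meromorphic_on simp: analytic_on_open o_def)
  have mpsi: "(\<lambda>u. psi (vac \<Phi> N w) s c (g u)) meromorphic_on UNIV"
    if "g holomorphic_on UNIV" for c g
    unfolding psi_def
    by (cases "c = Plain 1"; cases "c = Bar 1")
       (auto intro!: meromorphic_intros mv holomorphic_intros that)
  have mbox: "(\<lambda>u. boxfn (vac \<Phi> N w) (Qfun \<Phi> M v) s c (g u)) meromorphic_on UNIV"
    if "g holomorphic_on UNIV" for c g
    by (cases c) (auto intro!: meromorphic_intros mpsi mQ holomorphic_intros that)
  have mF: "(\<lambda>u. Fnorm (vac \<Phi> N w) s m (g u)) meromorphic_on UNIV"
    if "g holomorphic_on UNIV" for g
    unfolding Fnorm_def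
    by (cases "m = 0") (auto intro!: meromorphic_intros mv holomorphic_intros that)
  have "(\<lambda>u. Ttilde \<Phi> N w M v s a m u) meromorphic_on UNIV"
    unfolding Ttilde_def Trect_def
    by (intro meromorphic_intros mbox mF holomorphic_intros)
  then show ?thesis by simp
qed

end

(*
  A row of a filling is an m-subset S of the 2s+1 letters, numbered 0,...,2s in increasing order.
  Complementing S and reversing the order of the letters sends it to a (2s+1-m)-subset, and this
  preserves the componentwise order of consecutive rows, so it maps the fillings with m columns
  bijectively to those with 2s+1-m columns. Normalized weights agree row by row: up to a sign, the
  Q-part of the box k at its position in S is h_k(z_k) / h_{k+1}(z_{k+1}), where z_{k+1} = z_k + 1
  if k is in S and z_{k+1} = z_k - 1 otherwise; for k not in S the reversed letter in the dual row
  contributes the inverse of the same expression. Hence the ratio of the Q-parts of the two rows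
  telescopes to h_0 / h_{2s+1} = 1. The vacuum parts deviate from the normalization only through
  the first and the last letter, which the duality interchanges.
*)
theory Submission
  imports Defs
begin

section \<open>Numbering the letters by 0, ..., 2s\<close>

text \<open>With \<open>Zero\<close> at the middle number \<open>s\<close>, the order of letters
  becomes the order of numbers and reversing the alphabet becomes subtraction from
  \<open>2 * s\<close>.\<close>

definition letter_of :: "nat \<Rightarrow> nat \<Rightarrow> letter" where
  "letter_of s k = (if k < s then Plain (Suc k) else if k = s then Zero else Bar (2 * s + 1 - k))"

lemma letter_of_prec:
  assumes "k \<le> 2 * s" "l \<le> 2 * s"
  shows "letter_of s k \<prec> letter_of s l \<longleftrightarrow> k < l"
  using assms by (auto simp: letter_of_def)

lemma inj_on_letter_of: "inj_on (letter_of s) {..2 * s}"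
  by (auto simp: inj_on_def letter_of_def split: if_splits)

lemma letter_of_preceq:
  assumes "k \<le> 2 * s" "l \<le> 2 * s"
  shows "letter_of s k \<preceq> letter_of s l \<longleftrightarrow> k \<le> l"
  using assms inj_on_letter_of[of s] by (auto simp: preceq_def letter_of_prec le_less inj_on_def)

lemma letters_eq: "letters s = letter_of s ` {..2 * s}"
proof (intro equalityI subsetI)
  fix c assume "c \<in> letters s"
  then consider a where "c = Plain a" "1 \<le> a" "a \<le> s" | "c = Zero"
    | a where "c = Bar a" "1 \<le> a" "a \<le> s"
    by (auto simp: letters_def)
  then show "c \<in> letter_of s ` {..2 * s}"
  proof cases
    case (1 a)
    then show ?thesis by (intro image_eqI[of _ _ "a - 1"]) (auto simp: letter_of_def)
  next
    case 2
    then show ?thesis by (intro image_eqI[of _ _ s]) (auto simp: letter_of_def)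
  next
    case (3 a)
    then show ?thesis by (intro image_eqI[of _ _ "2 * s + 1 - a"]) (auto simp: letter_of_def)
  qed
next
  fix c assume "c \<in> letter_of s ` {..2 * s}"
  then obtain k where k: "k \<le> 2 * s" "c = letter_of s k" by auto
  then have "2 * s + 1 - k \<in> {1..s}" if "k > s" using that by auto
  with k show "c \<in> letters s" by (auto simp: letter_of_def letters_def)
qed

section \<open>Increasing enumerations and counting functions of finite sets\<close>

lemma bij_betw_nth_sorted_list_of_set:
  assumes "finite S"
  shows "bij_betw ((!) (sorted_list_of_set S)) {..<card S} S"
  using assms by (intro bij_betw_nth) auto

text \<open>As the enumeration increases, the positions whose entries lie below \<open>k\<close>
  form an initial segment, and its length is the number of elements below \<open>k\<close>.\<close>

lemma nth_sorted_list_of_set_less_iff: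
  fixes S :: "nat set"
  assumes "finite S" "j < card S"
  shows "sorted_list_of_set S ! j < k \<longleftrightarrow> j < card (S \<inter> {..<k})"
proof -
  let ?l = "sorted_list_of_set S"
  let ?A = "{i. i < card S \<and> ?l ! i < k}"
  have mono: "?l ! i \<le> ?l ! i'" if "i \<le> i'" "i' < card S" for i i'
    using that assms(1) by (simp add: sorted_nth_mono)
  have "bij_betw ((!) ?l) ?A (S \<inter> {..<k})"
    using bij_betw_nth_sorted_list_of_set[OF assms(1)]
    by (auto simp: bij_betw_def inj_on_def)
  then have card: "card ?A = card (S \<inter> {..<k})"
    by (rule bij_betw_same_card)
  have fin: "finite ?A" by simp
  show ?thesis
  proof (cases "?l ! j < k")
    case True
    have "{..j} \<subseteq> ?A"
    proof
      fix i assume "i \<in> {..j}"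
      then show "i \<in> ?A" using True mono[of i j] assms(2) by simp
    qed
    from card_mono[OF fin this] show ?thesis using True card by simp
  next
    case False
    have "?A \<subseteq> {..<j}"
    proof
      fix i assume "i \<in> ?A"
      then show "i \<in> {..<j}" using False mono[of j i] by (cases "i < j") auto
    qed
    from card_mono[OF _ this] show ?thesis using False card by simp
  qed
qed

text \<open>This recovers the column of an entry from the set alone, so that later products can run
  over elements of \<open>S\<close> instead of positions.\<close>

lemma card_below_nth_sorted_list_of_set:
  fixes S :: "nat set"
  assumes "finite S" "j < card S"
  shows "card (S \<inter> {..<sorted_list_of_set S ! j}) = j"
proof (rule antisym)
  let ?l = "sorted_list_of_set S"
  show "card (S \<inter> {..<?l ! j}) \<le> j"
    using nth_sorted_list_of_set_less_iff[OF assms, of "?l ! j"] by simp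
  show "j \<le> card (S \<inter> {..<?l ! j})"
  proof (cases j)
    case (Suc i)
    have "?l ! i < ?l ! j"
      using assms Suc by (intro sorted_wrt_nth_less[OF strict_sorted_list_of_set]) auto
    then show ?thesis
      using nth_sorted_list_of_set_less_iff[of S i "?l ! j"] assms Suc by simp
  qed simp
qed

text \<open>For sets of equal size this is the componentwise order of the increasing enumerations.
  Counting functions are used because they behave simply under complement and reflection.\<close>

definition dominated :: "nat set \<Rightarrow> nat set \<Rightarrow> bool" where
  "dominated S T \<longleftrightarrow> (\<forall>k. card (T \<inter> {..<k}) \<le> card (S \<inter> {..<k}))"

lemma dominated_iff_nth_le:
  assumes "finite S" "finite T" "card S = m" "card T = m"
  shows "dominated S T \<longleftrightarrow>
    (\<forall>j<m. sorted_list_of_set S ! j \<le> sorted_list_of_set T ! j)" (is "?L \<longleftrightarrow> ?R")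
proof
  assume L: ?L
  show ?R
  proof (intro allI impI)
    fix j assume "j < m"
    then show "sorted_list_of_set S ! j \<le> sorted_list_of_set T ! j"
      using L nth_sorted_list_of_set_less_iff[of T j] nth_sorted_list_of_set_less_iff[of S j] assms
      by (metis dominated_def less_irrefl not_le order_less_le_trans)
  qed
next
  assume R: ?R
  show ?L
    unfolding dominated_def
  proof (intro allI leI notI)
    fix k assume *: "card (S \<inter> {..<k}) < card (T \<inter> {..<k})"
    \<comment> \<open>This is the first position at which the entry of \<open>S\<close> is at least
      \<open>k\<close>, whereas \<open>T\<close> still has an entry below \<open>k\<close>
      there.\<close>
    let ?j = "card (S \<inter> {..<k})"
    have "card (T \<inter> {..<k}) \<le> m" using assms by (metis card_mono inf_le1)
    with * have j: "?j < m" by simp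
    have "sorted_list_of_set T ! ?j < k"
      using nth_sorted_list_of_set_less_iff[of T ?j k] j * assms by simp
    moreover have "\<not> sorted_list_of_set S ! ?j < k"
      using nth_sorted_list_of_set_less_iff[of S ?j k] j assms by simp
    ultimately show False using R j by (meson le_less_trans)
  qed
qed

section \<open>Fillings as chains of subsets\<close>

definition row_chains :: "nat \<Rightarrow> nat \<Rightarrow> nat \<Rightarrow> (nat \<Rightarrow> nat set) set" where
  "row_chains s a m =
     {R \<in> {1..a} \<rightarrow>\<^sub>E {S. S \<subseteq> {..2 * s} \<and> card S = m}. \<forall>i\<in>{1..<a}. dominated (R i) (R (i + 1))}"

definition fill :: "nat \<Rightarrow> nat \<Rightarrow> nat \<Rightarrow> (nat \<Rightarrow> nat set) \<Rightarrow> nat \<times> nat \<Rightarrow> letter" where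
  "fill s a m R = (\<lambda>(i, j)\<in>{1..a} \<times> {1..m}. letter_of s (sorted_list_of_set (R i) ! (j - 1)))"

lemma row_chainsD:
  assumes "R \<in> row_chains s a m" "i \<in> {1..a}"
  shows "R i \<subseteq> {..2 * s}" "finite (R i)" "card (R i) = m"
proof -
  show *: "R i \<subseteq> {..2 * s}" "card (R i) = m"
    using assms by (auto simp: row_chains_def PiE_iff)
  show "finite (R i)" by (rule finite_subset[OF *(1)]) simp
qed

lemma fill_in_tableaux:
  assumes R: "R \<in> row_chains s a m"
  shows "fill s a m R \<in> tableaux s a m"
proof -
  note D = row_chainsD[OF R]
  have mem: "sorted_list_of_set (R i) ! j \<in> R i" if "i \<in> {1..a}" "j < m" for i j
    using bij_betw_nth_sorted_list_of_set[of "R i"] D[OF that(1)] that(2)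
    by (auto simp: bij_betw_def)
  have le: "sorted_list_of_set (R i) ! j \<le> 2 * s" if "i \<in> {1..a}" "j < m" for i j
    using mem[OF that] D(1)[OF that(1)] by auto
  have dom: "dominated (R i) (R (i + 1))" if "i \<in> {1..<a}" for i
    using R that by (auto simp: row_chains_def)
  have 1: "fill s a m R \<in> ({1..a} \<times> {1..m}) \<rightarrow>\<^sub>E letters s"
    using le by (auto simp: fill_def letters_eq)
  have 2: "fill s a m R (i, j) \<prec> fill s a m R (i, j + 1)" if "i \<in> {1..a}" "j \<in> {1..<m}" for i j
  proof -
    have "sorted_list_of_set (R i) ! (j - 1) < sorted_list_of_set (R i) ! j"
      using that D[OF that(1)]
      by (intro sorted_wrt_nth_less[OF strict_sorted_list_of_set]) auto
    then show ?thesis using that le by (auto simp: fill_def letter_of_prec)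
  qed
  have 3: "fill s a m R (i, j) \<preceq> fill s a m R (i + 1, j)" if "i \<in> {1..<a}" "j \<in> {1..m}" for i j
  proof -
    have "sorted_list_of_set (R i) ! (j - 1) \<le> sorted_list_of_set (R (i + 1)) ! (j - 1)"
      using dominated_iff_nth_le[of "R i" "R (i + 1)" m] dom[OF that(1)] D[of i] D[of "i + 1"] that
      by auto
    then show ?thesis using that le by (auto simp: fill_def letter_of_preceq)
  qed
  from 1 2 3 show ?thesis by (simp add: tableaux_def)
qed

lemma inj_on_fill: "inj_on (fill s a m) (row_chains s a m)"
proof (rule inj_onI)
  fix R R' assume R: "R \<in> row_chains s a m" and R': "R' \<in> row_chains s a m"
    and eq: "fill s a m R = fill s a m R'"
  have "R i = R' i" if i: "i \<in> {1..a}" for i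
  proof -
    note D = row_chainsD[OF R i] and D' = row_chainsD[OF R' i]
    have "sorted_list_of_set (R i) ! j = sorted_list_of_set (R' i) ! j" if "j < m" for j
    proof -
      have "letter_of s (sorted_list_of_set (R i) ! j) = letter_of s (sorted_list_of_set (R' i) ! j)"
        using fun_cong[OF eq, of "(i, Suc j)"] i that by (simp add: fill_def)
      moreover have "sorted_list_of_set (R i) ! j \<in> {..2 * s}" "sorted_list_of_set (R' i) ! j \<in> {..2 * s}"
        using bij_betw_nth_sorted_list_of_set[of "R i"] bij_betw_nth_sorted_list_of_set[of "R' i"]
          D D' that by (auto simp: bij_betw_def)
      ultimately show ?thesis using inj_on_letter_of by (metis inj_onD)
    qed
    then have "sorted_list_of_set (R i) = sorted_list_of_set (R' i)"
      using D D' by (intro nth_equalityI) auto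
    then show ?thesis using D D' by (metis set_sorted_list_of_set)
  qed
  with R R' show "R = R'" by (intro PiE_ext[of R "{1..a}" _ R']) (auto simp: row_chains_def)
qed

text \<open>Rows increase strictly, so each row is the sorted enumeration of its set of entries, and
  the column condition becomes domination of consecutive sets.\<close>

lemma tableaux_subset_fill: "tableaux s a m \<subseteq> fill s a m ` row_chains s a m"
proof
  fix b assume b: "b \<in> tableaux s a m"
  \<comment> \<open>Here \<open>f i j\<close> is the number of the letter in row \<open>i\<close>.
    Columns of a filling count from 1, positions in a sorted list from 0.\<close>
  define f where "f i j = inv_into {..2 * s} (letter_of s) (b (i, Suc j))" for i j
  define R where "R = (\<lambda>i\<in>{1..a}. f i ` {..<m})"
  have b_eq: "b (i, Suc j) = letter_of s (f i j)" and f_le: "f i j \<le> 2 * s"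
    if "i \<in> {1..a}" "j < m" for i j
  proof -
    have *: "b (i, Suc j) \<in> letter_of s ` {..2 * s}"
      using b that by (auto simp: tableaux_def PiE_iff letters_eq)
    show "b (i, Suc j) = letter_of s (f i j)" using * by (simp add: f_def f_inv_into_f)
    show "f i j \<le> 2 * s" using inv_into_into[OF *] by (simp add: f_def)
  qed
  have f_Suc: "f i j < f i (Suc j)" if i: "i \<in> {1..a}" and "Suc j < m" for i j
  proof -
    have "b (i, Suc j) \<prec> b (i, Suc (Suc j))" using b that by (auto simp: tableaux_def)
    then show ?thesis using that b_eq f_le letter_of_prec by simp
  qed
  have f_less: "f i j < f i j'" if i: "i \<in> {1..a}" and "j < j'" "j' < m" for i j j'
    using that(2,3)
  proof (induction j' rule: less_Suc_induct)
    case (1 j')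
    then show ?case using f_Suc[OF i] by simp
  next
    case (2 j j' k)
    then show ?case by simp
  qed
  have R_i: "sorted_list_of_set (R i) = map (f i) [0..<m]" "card (R i) = m" "R i \<subseteq> {..2 * s}"
    "finite (R i)"
    if i: "i \<in> {1..a}" for i
  proof -
    have "sorted_wrt (<) (map (f i) [0..<m])"
      by (auto simp: sorted_wrt_iff_nth_less intro: f_less[OF i])
    then have "sorted_list_of_set (set (map (f i) [0..<m])) = map (f i) [0..<m]"
      unfolding strict_sorted_iff by (intro sorted_list_of_set.idem_if_sorted_distinct) auto
    then show *: "sorted_list_of_set (R i) = map (f i) [0..<m]"
      using i by (simp add: R_def lessThan_atLeast0)
    from arg_cong[OF *, of length] show "card (R i) = m" by simp
    show "R i \<subseteq> {..2 * s}" "finite (R i)" using i f_le by (auto simp: R_def)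
  qed
  have "dominated (R i) (R (i + 1))" if i: "i \<in> {1..<a}" for i
  proof -
    have "f i j \<le> f (i + 1) j" if "j < m" for j
    proof -
      have "b (i, Suc j) \<preceq> b (i + 1, Suc j)" using b i that by (auto simp: tableaux_def)
      then show ?thesis
        using i that b_eq[of i j] b_eq[of "i + 1" j] f_le[of i j] f_le[of "i + 1" j]
        by (simp add: letter_of_preceq)
    qed
    then show ?thesis
      using R_i[of i] R_i[of "i + 1"] i by (subst dominated_iff_nth_le[where m = m]) auto
  qed
  moreover have "R \<in> {1..a} \<rightarrow>\<^sub>E {S. S \<subseteq> {..2 * s} \<and> card S = m}"
    unfolding PiE_iff using R_i(2,3) restrict_extensional[of _ "{1..a}"] by (simp add: R_def)
  ultimately have R: "R \<in> row_chains s a m"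
    unfolding row_chains_def by blast
  have "b = fill s a m R"
  proof (rule PiE_ext[of _ "{1..a} \<times> {1..m}"])
    show "b \<in> ({1..a} \<times> {1..m}) \<rightarrow>\<^sub>E letters s" using b by (simp add: tableaux_def)
    show "fill s a m R \<in> ({1..a} \<times> {1..m}) \<rightarrow>\<^sub>E letters s"
      using fill_in_tableaux[OF R] by (simp add: tableaux_def)
    fix x assume "x \<in> {1..a} \<times> {1..m}"
    then show "b x = fill s a m R x"
      using R_i(1) b_eq[of "fst x" "snd x - 1"] by (auto simp: fill_def)
  qed
  with R show "b \<in> fill s a m ` row_chains s a m" by blast
qed

lemma bij_betw_fill: "bij_betw (fill s a m) (row_chains s a m) (tableaux s a m)"
  unfolding bij_betw_def
  using inj_on_fill fill_in_tableaux tableaux_subset_fill by blast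

section \<open>Complementing and reversing a row\<close>

text \<open>The bound on \<open>k\<close> guards against truncated subtraction, which would make
  \<open>2 * s - k\<close> equal to 0 for every larger \<open>k\<close>.\<close>

definition dual_row :: "nat \<Rightarrow> nat set \<Rightarrow> nat set" where
  "dual_row s S = {k. k \<le> 2 * s \<and> 2 * s - k \<notin> S}"

lemma dual_row_eq_image: "dual_row s S = (\<lambda>k. 2 * s - k) ` ({..2 * s} - S)"
proof (intro equalityI subsetI)
  fix k assume "k \<in> dual_row s S"
  then show "k \<in> (\<lambda>k. 2 * s - k) ` ({..2 * s} - S)"
    by (intro image_eqI[of _ _ "2 * s - k"]) (auto simp: dual_row_def)
qed (auto simp: dual_row_def)

lemma dual_row_subset: "dual_row s S \<subseteq> {..2 * s}"
  by (auto simp: dual_row_def)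

lemma dual_row_dual_row: "S \<subseteq> {..2 * s} \<Longrightarrow> dual_row s (dual_row s S) = S"
  by (auto simp: dual_row_def)

lemma prod_dual_row: "prod f (dual_row s S) = (\<Prod>k\<in>{..2 * s} - S. f (2 * s - k))"
  unfolding dual_row_eq_image by (subst prod.reindex) (auto simp: inj_on_def)

text \<open>The dual entries below \<open>k\<close> are the reflections of those among the last
  \<open>k\<close> numbers that are missing from \<open>S\<close>. The additive form avoids
  truncated subtraction.\<close>

lemma card_dual_row_below:
  assumes S: "S \<subseteq> {..2 * s}" and k: "k \<le> 2 * s + 1"
  shows "card (dual_row s S \<inter> {..<k}) + card S = k + card (S \<inter> {..<2 * s + 1 - k})"
proof -
  let ?I = "{2 * s + 1 - k..<2 * s + 1}"
  have fin: "finite S" using S by (rule finite_subset) simp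
  have "dual_row s S \<inter> {..<k} = (\<lambda>k. 2 * s - k) ` (?I - S)"
    unfolding dual_row_eq_image using k by auto
  moreover have "inj_on (\<lambda>k. 2 * s - k) (?I - S)" by (auto simp: inj_on_def)
  ultimately have 1: "card (dual_row s S \<inter> {..<k}) = card (?I - S)"
    by (simp only: card_image)
  have "card (?I - S) + card (?I \<inter> S) = card ?I"
    using card_Int_Diff[of ?I S] by simp
  moreover have "S - {..<2 * s + 1 - k} = ?I \<inter> S" using S by auto
  then have "card (S \<inter> {..<2 * s + 1 - k}) + card (?I \<inter> S) = card S"
    using card_Int_Diff[OF fin, of "{..<2 * s + 1 - k}"] by simp
  ultimately show ?thesis using 1 k by simp
qed

lemma card_dual_row:
  assumes "S \<subseteq> {..2 * s}"
  shows "card (dual_row s S) = 2 * s + 1 - card S"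
proof -
  have "dual_row s S \<inter> {..<2 * s + 1} = dual_row s S" by (auto simp: dual_row_def)
  then show ?thesis using card_dual_row_below[OF assms order_refl] by simp
qed

text \<open>By the counting formula, the dual counts of \<open>S\<close> and \<open>T\<close> arise
  from counts of \<open>S\<close> and \<open>T\<close> themselves by adding the same constant, so
  the inequality keeps its direction.\<close>

lemma dominated_dual_row:
  assumes "S \<subseteq> {..2 * s}" "T \<subseteq> {..2 * s}" "card S = card T" "dominated S T"
  shows "dominated (dual_row s S) (dual_row s T)"
  unfolding dominated_def
proof
  fix k
  \<comment> \<open>The counting formula covers \<open>k\<close> only up to
    \<open>2 * s + 1\<close>; beyond that the counts are constant.\<close>
  have *: "dual_row s X \<inter> {..<k} = dual_row s X \<inter> {..<min k (2 * s + 1)}" for X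
    by (auto simp: dual_row_def)
  have "card (T \<inter> {..<2 * s + 1 - min k (2 * s + 1)})
      \<le> card (S \<inter> {..<2 * s + 1 - min k (2 * s + 1)})"
    using assms(4) unfolding dominated_def by blast
  then show "card (dual_row s T \<inter> {..<k}) \<le> card (dual_row s S \<inter> {..<k})"
    using card_dual_row_below[OF assms(1), of "min k (2 * s + 1)"]
      card_dual_row_below[OF assms(2), of "min k (2 * s + 1)"] assms(3)
    unfolding *[of S] *[of T] by simp
qed

lemma dual_row_chain:
  assumes "R \<in> row_chains s a m"
  shows "(\<lambda>i\<in>{1..a}. dual_row s (R i)) \<in> row_chains s a (2 * s + 1 - m)"
proof -
  note D = row_chainsD[OF assms]
  have "dominated (dual_row s (R i)) (dual_row s (R (i + 1)))" if "i \<in> {1..<a}" for i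
    using assms that D[of i] D[of "i + 1"]
    by (intro dominated_dual_row) (auto simp: row_chains_def)
  moreover have "card (dual_row s (R i)) = 2 * s + 1 - m" if "i \<in> {1..a}" for i
    using card_dual_row D[OF that] by metis
  ultimately show ?thesis
    unfolding row_chains_def using dual_row_subset by auto
qed

lemma restrict_dual_dual:
  assumes "R \<in> row_chains s a m"
  shows "(\<lambda>i\<in>{1..a}. dual_row s ((\<lambda>i\<in>{1..a}. dual_row s (R i)) i)) = R"
proof
  fix i
  show "(\<lambda>i\<in>{1..a}. dual_row s ((\<lambda>i\<in>{1..a}. dual_row s (R i)) i)) i = R i"
  proof (cases "i \<in> {1..a}")
    case True
    then show ?thesis using dual_row_dual_row row_chainsD(1)[OF assms True] by auto
  next
    case False
    then show ?thesis using assms PiE_arb[of R "{1..a}" _ i] unfolding row_chains_def by auto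
  qed
qed

text \<open>Rowwise duality is an involution, so the same operation serves as inverse. The bound on
  \<open>m\<close> ensures that dualizing twice restores the number of columns.\<close>

lemma bij_betw_dual_row_chains:
  assumes "m \<le> 2 * s + 1"
  shows "bij_betw (\<lambda>R. \<lambda>i\<in>{1..a}. dual_row s (R i)) (row_chains s a m) (row_chains s a (2 * s + 1 - m))"
proof (rule bij_betw_byWitness[where f' = "\<lambda>R. \<lambda>i\<in>{1..a}. dual_row s (R i)"])
  have "2 * s + 1 - (2 * s + 1 - m) = m" using assms by simp
  then show "(\<lambda>R. \<lambda>i\<in>{1..a}. dual_row s (R i)) ` row_chains s a (2 * s + 1 - m) \<subseteq> row_chains s a m"
    using dual_row_chain[of _ s a "2 * s + 1 - m"] by auto
qed (use restrict_dual_dual dual_row_chain in blast)+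

section \<open>Weights of single rows\<close>

text \<open>Here \<open>x\<close> is the centre of the row: the box arguments run from
  \<open>x - m + 1\<close> to \<open>x + m - 1\<close> in steps of 2, where \<open>m\<close> is the
  size of \<open>S\<close>. The count of smaller elements is the column number minus 1.\<close>

definition row_weight :: "(complex \<Rightarrow> complex) \<Rightarrow> (nat \<Rightarrow> complex \<Rightarrow> complex) \<Rightarrow> nat
    \<Rightarrow> nat set \<Rightarrow> complex \<Rightarrow> complex" where
  "row_weight \<phi> Q s S x =
     (\<Prod>k\<in>S. (-1) ^ parity (letter_of s k) *
        boxfn \<phi> Q s (letter_of s k)
          (x - of_nat (card S) + 1 + 2 * of_nat (card (S \<inter> {..<k}))))"

lemma Trect_eq_sum_row_chains:
  "Trect \<phi> Q s a m u =
     (\<Sum>R\<in>row_chains s a m. \<Prod>i=1..a.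
        row_weight \<phi> Q s (R i) (u + of_nat a - 2 * of_nat i + 1))"
proof -
  have "(\<Prod>j=1..m. (-1) ^ parity (fill s a m R (i, j)) * boxfn \<phi> Q s (fill s a m R (i, j))
            (u - of_nat m + of_nat a - 2 * of_nat i + 2 * of_nat j)) =
        row_weight \<phi> Q s (R i) (u + of_nat a - 2 * of_nat i + 1)" (is "?lhs = _")
    if R: "R \<in> row_chains s a m" and i: "i \<in> {1..a}" for R i
  proof -
    note D = row_chainsD[OF R i]
    let ?l = "sorted_list_of_set (R i)"
    have "?lhs = (\<Prod>j<m. (-1) ^ parity (letter_of s (?l ! j)) * boxfn \<phi> Q s (letter_of s (?l ! j))
            (u - of_nat m + of_nat a - 2 * of_nat i + 2 * of_nat (Suc j)))"
      unfolding One_nat_def prod.atLeast1_atMost_eq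
      using i by (intro prod.cong refl) (simp add: fill_def)
    also have "\<dots> = (\<Prod>j<m. (-1) ^ parity (letter_of s (?l ! j)) * boxfn \<phi> Q s (letter_of s (?l ! j))
            (u + of_nat a - 2 * of_nat i + 1 - of_nat (card (R i)) + 1
              + 2 * of_nat (card (R i \<inter> {..<?l ! j}))))"
      using D card_below_nth_sorted_list_of_set[of "R i"]
      by (intro prod.cong refl) (simp add: algebra_simps)
    also have "\<dots> = row_weight \<phi> Q s (R i) (u + of_nat a - 2 * of_nat i + 1)"
      unfolding row_weight_def
      using bij_betw_nth_sorted_list_of_set[OF D(2)] D(3)
      by (intro prod.reindex_bij_betw) auto
    finally show ?thesis .
  qed
  then show ?thesis
    unfolding Trect_def
    by (subst sum.reindex_bij_betw[OF bij_betw_fill, symmetric]) (intro sum.cong prod.cong refl, simp)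
qed

text \<open>This is h_k(z) of the opening overview. The index of \<open>Q\<close> runs through 0,
  ..., s, s, ..., 0 as \<open>k\<close> goes from 0 to \<open>2 * s + 1\<close>.\<close>

definition Q_ratio :: "(nat \<Rightarrow> complex \<Rightarrow> complex) \<Rightarrow> nat \<Rightarrow> nat \<Rightarrow> complex \<Rightarrow> complex" where
  "Q_ratio Q s k z = Q (min k (2 * s + 1 - k)) (z - 2) / Q (min k (2 * s + 1 - k)) z"

lemma boxfn_letter_of:
  assumes "k \<le> 2 * s"
  shows "boxfn \<phi> Q s (letter_of s k) x =
    psi \<phi> s (letter_of s k) x *
      (Q_ratio Q s k (x - of_nat k) / Q_ratio Q s (Suc k) (x - of_nat k + 1))"
proof -
  \<comment> \<open>The folded index rises for unbarred letters, stays at \<open>s\<close> across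
    \<open>Zero\<close>, and falls for barred letters.\<close>
  consider "k < s" | "k = s" | l where "k = Suc (s + l)" "l < s"
    using assms less_imp_Suc_add[of s k] by (cases k s rule: linorder_cases) auto
  then show ?thesis
  proof cases
    case 1
    then have "min k (2 * s + 1 - k) = k" "min (Suc k) (2 * s + 1 - Suc k) = Suc k" by auto
    then show ?thesis using 1 by (simp add: letter_of_def Q_ratio_def algebra_simps)
  next
    case 2
    then have "min k (2 * s + 1 - k) = s" "min (Suc k) (2 * s + 1 - Suc k) = s" by auto
    then show ?thesis using 2 by (simp add: letter_of_def Q_ratio_def algebra_simps)
  next
    case (3 l)
    have "min k (2 * s + 1 - k) = s - l" "min (Suc k) (2 * s + 1 - Suc k) = s - l - 1"
      "2 * s + 1 - k = s - l"
      using 3 by auto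
    then show ?thesis using 3 by (simp add: letter_of_def Q_ratio_def of_nat_diff algebra_simps)
  qed
qed

text \<open>Because of this symmetry the letters \<open>k\<close> and \<open>2 * s - k\<close>
  involve the same two ratio functions with numerator and denominator exchanged.\<close>

lemma Q_ratio_reflect: "k \<le> 2 * s + 1 \<Longrightarrow> Q_ratio Q s (2 * s + 1 - k) = Q_ratio Q s k"
  by (simp add: Q_ratio_def fun_eq_iff min.commute)

text \<open>If every letter had the generic vacuum factor, the row would give \<open>Fnorm\<close>
  times one extra factor at each end. The first letter can only stand in the first column and the
  last letter only in the last; each shifts the extra factor at its end by 2.\<close>

lemma prod_psi_row:
  fixes x :: complex
  assumes S: "S \<subseteq> {..2 * s}" "card S = m" and s: "s \<ge> 1"
    and nz: "\<And>n. \<phi> (x + of_int n) \<noteq> 0"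
  shows "(\<Prod>k\<in>S. psi \<phi> s (letter_of s k) (x - of_nat m + 1 + 2 * of_nat (card (S \<inter> {..<k})))) =
    Fnorm \<phi> s m x *
      (\<phi> (if 0 \<in> S then x - of_nat m - 1 else x - of_nat m + 1) *
       \<phi> (if 2 * s \<in> S then x + of_nat m - 2 * of_nat s else x + of_nat m - 2 - 2 * of_nat s))"
proof -
  define X :: "nat \<Rightarrow> complex" where "X k = x - of_nat m + 1 + 2 * of_nat (card (S \<inter> {..<k}))" for k
  define gen :: "complex \<Rightarrow> complex" where "gen y = \<phi> y * \<phi> (y - 2 * of_nat s - 1)" for y
  define D0 where "D0 = \<phi> (x - of_nat m + 1)"
  define D1 where "D1 = \<phi> (x + of_nat m - 2 - 2 * of_nat s)"
  have fin: "finite S" using S(1) by (rule finite_subset) simp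
  have D0: "D0 \<noteq> 0" using nz[of "1 - int m"] by (simp add: D0_def algebra_simps)
  have D1: "D1 \<noteq> 0" using nz[of "int m - 2 - 2 * int s"] by (simp add: D1_def algebra_simps)
  have X0: "X 0 = x - of_nat m + 1" by (simp add: X_def)
  \<comment> \<open>The number \<open>2 * s\<close> is the largest possible entry, hence sits in the
    last column.\<close>
  have X1: "X (2 * s) = x + of_nat m - 1" if "2 * s \<in> S"
  proof -
    have "S = insert (2 * s) (S \<inter> {..<2 * s})" using that S(1) by fastforce
    then have "m = card (insert (2 * s) (S \<inter> {..<2 * s}))" using S(2) by simp
    then have "m = Suc (card (S \<inter> {..<2 * s}))" using fin by simp
    then show ?thesis by (simp add: X_def)
  qed
  have X0': "x - of_nat m + 1 - 2 = x - of_nat m - 1"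
    by simp
  have X1': "X (2 * s) - 2 * of_nat s - 1 = x + of_nat m - 2 - 2 * of_nat s"
    "X (2 * s) - 2 * of_nat s + 1 = x + of_nat m - 2 * of_nat s" if "2 * s \<in> S"
    using X1[OF that] by simp_all
  have gen_prod: "(\<Prod>k\<in>S. gen (X k)) = (\<Prod>p<m. gen (x - of_nat m + 1 + 2 * of_nat p))"
  proof -
    have "(\<Prod>k\<in>S. gen (X k)) = (\<Prod>p<m. gen (X (sorted_list_of_set S ! p)))"
      using bij_betw_nth_sorted_list_of_set[OF fin] S(2)
      by (intro prod.reindex_bij_betw[symmetric]) auto
    then show ?thesis
      using card_below_nth_sorted_list_of_set[OF fin] S(2) by (simp add: X_def)
  qed
  have F: "Fnorm \<phi> s m x * (D0 * D1) = (\<Prod>p<m. gen (x - of_nat m + 1 + 2 * of_nat p))"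
  proof (cases m)
    \<comment> \<open>The empty product is 1, which is what the special value of
      \<open>Fnorm\<close> at 0 provides.\<close>
    case 0
    then show ?thesis using D0 D1 by (simp add: Fnorm_def D0_def D1_def algebra_simps)
  next
    case (Suc n)
    have "(\<Prod>p<m. gen (x - of_nat m + 1 + 2 * of_nat p)) =
        (\<Prod>p<Suc n. \<phi> (x - of_nat m + 1 + 2 * of_nat p)) *
        (\<Prod>p<Suc n. \<phi> (x - of_nat m + 2 * of_nat p - 2 * of_nat s))"
      by (simp add: gen_def Suc prod.distrib algebra_simps)
    \<comment> \<open>The first family gives up its term at \<open>p = 0\<close> as
      \<open>D0\<close>, the second its term at \<open>p = n\<close> as \<open>D1\<close>; the
      remaining terms are those of \<open>Fnorm\<close>.\<close>
    also have "(\<Prod>p<Suc n. \<phi> (x - of_nat m + 1 + 2 * of_nat p)) =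
        D0 * (\<Prod>p<n. \<phi> (x - of_nat m + 2 * of_nat (Suc p) + 1))"
      unfolding prod.lessThan_Suc_shift by (simp add: D0_def algebra_simps)
    also have "(\<Prod>p<Suc n. \<phi> (x - of_nat m + 2 * of_nat p - 2 * of_nat s)) =
        D1 * (\<Prod>p<n. \<phi> (x - 2 * of_nat s - of_nat m + 2 * of_nat (Suc p) - 2))"
      by (simp add: D1_def Suc algebra_simps)
    finally show ?thesis
      using Suc by (simp only: Fnorm_def One_nat_def prod.atLeast1_atMost_eq prod.distrib) simp
  qed
  \<comment> \<open>Multiplying across by the generic factors that the end letters replace compares
    \<open>psi\<close> with \<open>gen\<close> without division.\<close>
  have psi_gen: "psi \<phi> s (letter_of s k) y * ((if k = 0 then \<phi> y else 1) * (if k = 2 * s then \<phi> (y - 2 * of_nat s - 1) else 1))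
      = gen y * ((if k = 0 then \<phi> (y - 2) else 1) * (if k = 2 * s then \<phi> (y - 2 * of_nat s + 1) else 1))"
    if "k \<in> S" for k y
    using that s S(1) by (auto simp: psi_def letter_of_def gen_def)
  have "(\<Prod>k\<in>S. psi \<phi> s (letter_of s k) (X k) *
        ((if k = 0 then \<phi> (X k) else 1) * (if k = 2 * s then \<phi> (X k - 2 * of_nat s - 1) else 1))) =
      (\<Prod>k\<in>S. gen (X k) *
        ((if k = 0 then \<phi> (X k - 2) else 1) * (if k = 2 * s then \<phi> (X k - 2 * of_nat s + 1) else 1)))"
    by (intro prod.cong refl psi_gen)
  then have "(\<Prod>k\<in>S. psi \<phi> s (letter_of s k) (X k)) * ((if 0 \<in> S then \<phi> (X 0) else 1) *
        (if 2 * s \<in> S then \<phi> (X (2 * s) - 2 * of_nat s - 1) else 1)) =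
      (\<Prod>k\<in>S. gen (X k)) * ((if 0 \<in> S then \<phi> (X 0 - 2) else 1) *
        (if 2 * s \<in> S then \<phi> (X (2 * s) - 2 * of_nat s + 1) else 1))"
    by (simp only: prod.distrib prod.delta[OF fin])
  then have "(\<Prod>k\<in>S. psi \<phi> s (letter_of s k) (X k)) * ((if 0 \<in> S then D0 else 1) *
        (if 2 * s \<in> S then D1 else 1)) =
      Fnorm \<phi> s m x * (D0 * D1) * ((if 0 \<in> S then \<phi> (x - of_nat m - 1) else 1) *
        (if 2 * s \<in> S then \<phi> (x + of_nat m - 2 * of_nat s) else 1))"
    by (cases "0 \<in> S"; cases "2 * s \<in> S")
      (simp_all only: gen_prod F[symmetric] X0 X0' X1' D0_def D1_def if_True if_False)
  then show ?thesis
    using D0 D1 unfolding X_def[symmetric]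
    by (simp add: D0_def[symmetric] D1_def[symmetric] split: if_splits)
qed

section \<open>Duality for a single row\<close>

lemma prod_inverse_eq_prod_Diff:
  fixes r :: "'a \<Rightarrow> 'b :: field"
  assumes "finite U" "S \<subseteq> U" "prod r U = 1"
  shows "(\<Prod>k\<in>S. inverse (r k)) = prod r (U - S)"
proof -
  have "prod r (U - S) * prod r S = 1"
    using assms by (simp add: prod.subset_diff[symmetric])
  then have "inverse (prod r S) = prod r (U - S)"
    by (intro inverse_unique) (simp add: mult.commute)
  then show ?thesis using prod_inversef[of r S] by (simp add: o_def)
qed

text \<open>All arguments that occur differ from \<open>x\<close> by integers, so the hypotheses on
  integer shifts exclude every zero that could spoil a cancellation.\<close>

lemma row_weight_dual_row:
  fixes x :: complex
  assumes S: "S \<subseteq> {..2 * s}" and s: "s \<ge> 1"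
    and nz: "\<And>n. \<phi> (x + of_int n) \<noteq> 0" and Qnz: "\<And>k n. Q k (x + of_int n) \<noteq> 0"
    and Q0: "\<And>y. Q 0 y = 1"
  shows "row_weight \<phi> Q s (dual_row s S) x / Fnorm \<phi> s (2 * s + 1 - card S) x =
    row_weight \<phi> Q s S x / Fnorm \<phi> s (card S) x"
proof -
  define m where "m = card S"
  define m' where "m' = 2 * s + 1 - m"
  define p where "p T k = card (T \<inter> {..<k})" for T :: "nat set" and k
  \<comment> \<open>\<open>X T k\<close> makes sense also for \<open>k\<close> outside
    \<open>T\<close>. Thus z_k = \<open>X S k - of_nat k\<close> is defined for all
    \<open>k\<close>; it goes up by 1 after an element of \<open>S\<close> and down by 1
    otherwise.\<close>
  define X where "X T k = x - of_nat (card T) + 1 + 2 * of_nat (p T k)" for T k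
  define r where "r = (\<lambda>k. (-1) ^ parity (letter_of s k) *
    (Q_ratio Q s (Suc k) (X S (Suc k) - of_nat (Suc k)) / Q_ratio Q s k (X S k - of_nat k)))"
  let ?T = "dual_row s S"
  have fin: "finite S" using S by (rule finite_subset) simp
  have m: "m \<le> 2 * s + 1" using card_mono[OF _ S] by (simp add: m_def)
  have card_T: "card ?T = m'" using card_dual_row[OF S] by (simp add: m'_def m_def)
  have ratio_nz: "Q_ratio Q s k (X S k' - of_nat l) \<noteq> 0" for k k' l
    using Qnz[of _ "1 + 2 * int (p S k') - int m - int l"]
      Qnz[of _ "1 + 2 * int (p S k') - int m - int l - 2"]
    by (simp add: Q_ratio_def X_def m_def algebra_simps)
  have p_Suc: "p S (Suc k) = (if k \<in> S then Suc (p S k) else p S k)" for k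
    using fin by (auto simp: p_def lessThan_Suc Int_insert_right)
  have in_S: "(-1) ^ parity (letter_of s k) *
      (Q_ratio Q s k (X S k - of_nat k) / Q_ratio Q s (Suc k) (X S k - of_nat k + 1)) = inverse (r k)"
    if "k \<in> S" for k
  proof -
    have "X S (Suc k) - of_nat (Suc k) = X S k - of_nat k + 1"
      using that by (simp add: X_def p_Suc)
    moreover have "inverse ((-1) ^ n :: complex) = (-1) ^ n" for n :: nat
      by (simp add: power_inverse[symmetric])
    ultimately show ?thesis unfolding r_def by (simp only: inverse_mult_distrib inverse_divide)
  qed
  \<comment> \<open>The reversed letter in the dual row is evaluated at z_{k+1}, which is what swaps
    the two arguments in its ratio.\<close>
  have X_T: "X ?T (2 * s - k) - of_nat (2 * s - k) = X S (Suc k) - of_nat (Suc k)"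
    if "k \<le> 2 * s" "k \<notin> S" for k
  proof -
    have "p ?T (2 * s - k) + m = 2 * s - k + p S (Suc k)"
      using card_dual_row_below[OF S, of "2 * s - k"] that by (simp add: p_def m_def Suc_diff_le)
    then have "p ?T (2 * s - k) + m + k = 2 * s + p S (Suc k)" using that by simp
    from arg_cong[OF this, of "of_nat :: nat \<Rightarrow> complex"]
    have *: "of_nat (p ?T (2 * s - k)) = (2 * of_nat s + of_nat (p S (Suc k)) - of_nat m - of_nat k :: complex)"
      by (simp add: algebra_simps)
    have **: "(of_nat m' :: complex) = 2 * of_nat s + 1 - of_nat m"
      "(of_nat (2 * s - k) :: complex) = 2 * of_nat s - of_nat k"
      using m that by (simp_all add: m'_def of_nat_diff)
    show ?thesis
      unfolding X_def card_T m_def[symmetric] * ** by (simp add: algebra_simps)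
  qed
  have notin_S: "(-1) ^ parity (letter_of s (2 * s - k)) *
      (Q_ratio Q s (2 * s - k) (X ?T (2 * s - k) - of_nat (2 * s - k)) /
       Q_ratio Q s (Suc (2 * s - k)) (X ?T (2 * s - k) - of_nat (2 * s - k) + 1)) = r k"
    if k: "k \<le> 2 * s" "k \<notin> S" for k
  proof -
    have "parity (letter_of s (2 * s - k)) = parity (letter_of s k)"
      using k by (auto simp: letter_of_def)
    moreover have "Q_ratio Q s (2 * s - k) = Q_ratio Q s (Suc k)"
      using Q_ratio_reflect[of "Suc k" s Q] k by simp
    moreover have "Q_ratio Q s (Suc (2 * s - k)) = Q_ratio Q s k"
      using Q_ratio_reflect[of k s Q] k by (simp add: Suc_diff_le)
    moreover have "X S (Suc k) - of_nat (Suc k) + 1 = X S k - of_nat k"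
      using k by (simp add: X_def p_Suc)
    ultimately show ?thesis by (simp only: X_T[OF k] r_def)
  qed
  have "prod r {..2 * s} = 1"
  proof -
    \<comment> \<open>Only the middle letter has parity 0, so the signs are \<open>2 * s\<close>
      factors of -1.\<close>
    have "(\<Prod>k\<le>2 * s. (-1) ^ parity (letter_of s k) :: complex) =
        (\<Prod>k\<in>{..2 * s} - {s}. (-1) ^ parity (letter_of s k))"
      by (subst prod.remove[of _ s]) (auto simp: letter_of_def)
    also have "\<dots> = (\<Prod>k\<in>{..2 * s} - {s}. -1)"
      by (intro prod.cong refl) (auto simp: letter_of_def)
    also have "\<dots> = 1" by simp
    finally have 1: "(\<Prod>k\<le>2 * s. (-1) ^ parity (letter_of s k) :: complex) = 1" .
    \<comment> \<open>The ratios telescope to the indices 0 and \<open>2 * s + 1\<close>; both fold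
      to \<open>Q 0\<close>, which is 1.\<close>
    have "(\<Prod>k\<le>2 * s. Q_ratio Q s (Suc k) (X S (Suc k) - of_nat (Suc k)) / Q_ratio Q s k (X S k - of_nat k)) =
        Q_ratio Q s (2 * s + 1) (X S (2 * s + 1) - of_nat (2 * s + 1)) / Q_ratio Q s 0 (X S 0 - of_nat 0)"
      unfolding lessThan_Suc_atMost[symmetric] using ratio_nz
      by (subst prod_lessThan_telescope[where f = "\<lambda>k. Q_ratio Q s k (X S k - of_nat k)"]) auto
    also have "\<dots> = 1" by (simp add: Q_ratio_def Q0)
    finally show ?thesis unfolding r_def prod.distrib 1 by simp
  qed
  then have tele: "(\<Prod>k\<in>S. inverse (r k)) = prod r ({..2 * s} - S)"
    using S by (intro prod_inverse_eq_prod_Diff) auto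
  have weight: "row_weight \<phi> Q s T x = (\<Prod>k\<in>T. psi \<phi> s (letter_of s k) (X T k)) *
      (\<Prod>k\<in>T. (-1) ^ parity (letter_of s k) *
        (Q_ratio Q s k (X T k - of_nat k) / Q_ratio Q s (Suc k) (X T k - of_nat k + 1)))"
    if "T \<subseteq> {..2 * s}" for T
    unfolding row_weight_def prod.distrib[symmetric] X_def[symmetric] p_def[symmetric]
  proof (intro prod.cong refl)
    fix k assume "k \<in> T"
    with that have "k \<le> 2 * s" by auto
    then show "(-1) ^ parity (letter_of s k) * boxfn \<phi> Q s (letter_of s k) (X T k) =
        psi \<phi> s (letter_of s k) (X T k) * ((-1) ^ parity (letter_of s k) *
        (Q_ratio Q s k (X T k - of_nat k) / Q_ratio Q s (Suc k) (X T k - of_nat k + 1)))"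
      by (simp only: boxfn_letter_of mult_ac)
  qed
  have wS: "row_weight \<phi> Q s S x = (\<Prod>k\<in>S. psi \<phi> s (letter_of s k) (X S k)) * (\<Prod>k\<in>S. inverse (r k))"
    unfolding weight[OF S] using in_S by simp
  note weight[OF dual_row_subset, of S]
  also have "(\<Prod>k\<in>?T. (-1) ^ parity (letter_of s k) *
        (Q_ratio Q s k (X ?T k - of_nat k) / Q_ratio Q s (Suc k) (X ?T k - of_nat k + 1))) =
      prod r ({..2 * s} - S)"
    unfolding prod_dual_row using notin_S by (intro prod.cong refl) auto
  finally have wT: "row_weight \<phi> Q s ?T x =
    (\<Prod>k\<in>?T. psi \<phi> s (letter_of s k) (X ?T k)) * (\<Prod>k\<in>S. inverse (r k))"
    by (simp only: tele)
  have Fnz: "Fnorm \<phi> s n x \<noteq> 0" for n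
  proof (cases "n = 0")
    case True
    then show ?thesis using nz[of 1] nz[of "- 2 * int s - 2"] by (simp add: Fnorm_def algebra_simps)
  next
    case False
    have "\<phi> (x - of_nat n + 2 * of_nat j + 1) * \<phi> (x - 2 * of_nat s - of_nat n + 2 * of_nat j - 2) \<noteq> 0" for j
      using nz[of "2 * int j + 1 - int n"] nz[of "2 * int j - 2 - int n - 2 * int s"]
      by (simp add: algebra_simps)
    with False show ?thesis by (simp add: Fnorm_def)
  qed
  have mem: "0 \<in> ?T \<longleftrightarrow> 2 * s \<notin> S" "2 * s \<in> ?T \<longleftrightarrow> 0 \<notin> S"
    by (auto simp: dual_row_def)
  have m': "(of_nat m' :: complex) = 2 * of_nat s + 1 - of_nat m"
    using m by (simp add: m'_def of_nat_diff)
  have "row_weight \<phi> Q s S x / Fnorm \<phi> s m x =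
      \<phi> (if 0 \<in> S then x - of_nat m - 1 else x - of_nat m + 1) *
      \<phi> (if 2 * s \<in> S then x + of_nat m - 2 * of_nat s else x + of_nat m - 2 - 2 * of_nat s) *
      (\<Prod>k\<in>S. inverse (r k))"
    unfolding wS using prod_psi_row[where \<phi> = \<phi>, OF S m_def[symmetric] s nz] Fnz
    by (simp add: X_def p_def m_def)
  \<comment> \<open>Substituting \<open>m'\<close> turns the left end factor of the dual row into
    the right end factor of \<open>S\<close>, and vice versa.\<close>
  also have "\<dots> = \<phi> (if 0 \<in> ?T then x - of_nat m' - 1 else x - of_nat m' + 1) *
      \<phi> (if 2 * s \<in> ?T then x + of_nat m' - 2 * of_nat s else x + of_nat m' - 2 - 2 * of_nat s) *
      (\<Prod>k\<in>S. inverse (r k))"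
    unfolding mem m' by (simp add: algebra_simps)
  also have "\<dots> = row_weight \<phi> Q s ?T x / Fnorm \<phi> s m' x"
    unfolding wT using prod_psi_row[where \<phi> = \<phi>, OF dual_row_subset card_T s nz] Fnz
    by (simp add: X_def p_def card_T)
  finally show ?thesis by (simp add: m'_def m_def)
qed

section \<open>Summation over fillings and passage to meromorphic functions\<close>

text \<open>Row centres do not depend on the number of columns, so the normalization distributes
  over the rows and the single-row identity applies factor by factor.\<close>

lemma Trect_div_Fnorm_dual:
  fixes u :: complex
  assumes m: "m \<le> 2 * s + 1" and s: "s \<ge> 1"
    and nz: "\<And>n. \<phi> (u + of_int n) \<noteq> 0" and Qnz: "\<And>k n. Q k (u + of_int n) \<noteq> 0"
    and Q0: "\<And>y. Q 0 y = 1"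
  shows "Trect \<phi> Q s a m u / (\<Prod>j=1..a. Fnorm \<phi> s m (u + of_nat a - 2 * of_nat j + 1)) =
    Trect \<phi> Q s a (2 * s + 1 - m) u /
      (\<Prod>j=1..a. Fnorm \<phi> s (2 * s + 1 - m) (u + of_nat a - 2 * of_nat j + 1))"
proof -
  have row: "row_weight \<phi> Q s (dual_row s S) (u + of_nat a - 2 * of_nat i + 1) /
        Fnorm \<phi> s (2 * s + 1 - m) (u + of_nat a - 2 * of_nat i + 1) =
      row_weight \<phi> Q s S (u + of_nat a - 2 * of_nat i + 1) /
        Fnorm \<phi> s m (u + of_nat a - 2 * of_nat i + 1)"
    if "S \<subseteq> {..2 * s}" "card S = m" for S i
  proof -
    have "u + of_nat a - 2 * of_nat i + 1 + of_int n = u + of_int (int a - 2 * int i + 1 + n)" for n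
      by simp
    then show ?thesis
      using row_weight_dual_row[where x = "u + of_nat a - 2 * of_nat i + 1" and \<phi> = \<phi> and Q = Q,
          OF that(1) s] nz Qnz Q0 that(2) by metis
  qed
  have "Trect \<phi> Q s a m u / (\<Prod>j=1..a. Fnorm \<phi> s m (u + of_nat a - 2 * of_nat j + 1)) =
      (\<Sum>R\<in>row_chains s a m. \<Prod>i=1..a. row_weight \<phi> Q s (R i) (u + of_nat a - 2 * of_nat i + 1) /
        Fnorm \<phi> s m (u + of_nat a - 2 * of_nat i + 1))"
    by (simp add: Trect_eq_sum_row_chains sum_divide_distrib prod_dividef)
  also have "\<dots> = (\<Sum>R\<in>row_chains s a m. \<Prod>i=1..a.
        row_weight \<phi> Q s ((\<lambda>i\<in>{1..a}. dual_row s (R i)) i) (u + of_nat a - 2 * of_nat i + 1) /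
        Fnorm \<phi> s (2 * s + 1 - m) (u + of_nat a - 2 * of_nat i + 1))"
    using row_chainsD row by (intro sum.cong prod.cong refl) simp
  also have "\<dots> = (\<Sum>R\<in>row_chains s a (2 * s + 1 - m). \<Prod>i=1..a.
        row_weight \<phi> Q s (R i) (u + of_nat a - 2 * of_nat i + 1) /
        Fnorm \<phi> s (2 * s + 1 - m) (u + of_nat a - 2 * of_nat i + 1))"
    by (rule sum.reindex_bij_betw[OF bij_betw_dual_row_chains[OF m]])
  also have "\<dots> = Trect \<phi> Q s a (2 * s + 1 - m) u /
      (\<Prod>j=1..a. Fnorm \<phi> s (2 * s + 1 - m) (u + of_nat a - 2 * of_nat j + 1))"
    by (simp add: Trect_eq_sum_row_chains sum_divide_distrib prod_dividef)
  finally show ?thesis .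
qed

text \<open>On the connected plane the difference either vanishes or is nonzero on a cosparse set.
  In the latter case the plane would be a union of two countable sets. Hence the exceptional set
  need only be countable, not discrete.\<close>

lemma meromorphic_eq_cosparse_if_countable:
  fixes f g :: "complex \<Rightarrow> complex"
  assumes "f meromorphic_on UNIV" "g meromorphic_on UNIV" and count: "countable {z. f z \<noteq> g z}"
  shows "\<forall>\<^sub>F z in cosparse UNIV. f z = g z"
proof -
  have "(\<lambda>z. f z - g z) meromorphic_on UNIV" by (intro meromorphic_intros assms)
  from meromorphic_imp_constant_or_avoid[OF this open_UNIV connected_UNIV, of 0]
  consider "\<forall>\<^sub>F z in cosparse UNIV. f z - g z = 0" | "\<forall>\<^sub>F z in cosparse UNIV. f z - g z \<noteq> 0"
    by auto
  then show ?thesis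
  proof cases
    case 2
    then have "{z. f z = g z} sparse_in UNIV" by (simp add: eventually_cosparse)
    from sparse_imp_countable[OF open_UNIV this] have "countable {z. f z = g z}" by simp
    with count have "countable ({z. f z = g z} \<union> {z. f z \<noteq> g z})" by (rule countable_Un[rotated])
    then have "countable (UNIV :: complex set)" by (simp add: Un_def)
    then show ?thesis using uncountable_UNIV_complex by simp
  qed simp
qed

theorem mainTheorem5:
  fixes \<Phi> :: "complex \<Rightarrow> complex"
    and N :: nat and w :: "nat \<Rightarrow> complex"
    and M :: "nat \<Rightarrow> nat" and v :: "nat \<Rightarrow> nat \<Rightarrow> complex"
    and s a m :: nat
  assumes "\<Phi> holomorphic_on UNIV"
    and "\<exists>z. \<Phi> z \<noteq> 0"
    and "\<Phi> 0 = 0"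
    and "s \<ge> 1"
    and "a \<ge> 1"
    and "m \<le> 2 * s + 1"
  shows "\<forall>\<^sub>F u in cosparse UNIV.
           Ttilde \<Phi> N w M v s a m u = Ttilde \<Phi> N w M v s a (2 * s + 1 - m) u"
proof (rule meromorphic_eq_cosparse_if_countable)
  define Z where "Z = {z. \<Phi> z = 0}"
  \<comment> \<open>Shifting the zeros by all integers avoids tracking the arguments that occur; these shifts may
    accumulate, but they form a countable set.\<close>
  define P where "P n c = (\<lambda>z. z + c - of_int n) ` Z" for n :: int and c
  define E where "E = (\<Union>n. \<Union>j. P n (w j)) \<union> (\<Union>n. \<Union>k. \<Union>j. P n (v k j))"
  \<comment> \<open>The zero at 0 together with a nonzero value rules out a constant, and then the
    identity theorem makes the zero set countable.\<close>
  have "\<not> \<Phi> constant_on UNIV" using assms(2,3) by (metis UNIV_I constant_on_def)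
  then have "countable Z"
    using holomorphic_countable_zeros[OF assms(1) open_UNIV connected_UNIV] closed_imp_fsigma_in
    by (simp add: Z_def)
  then have E: "countable E" by (simp add: E_def P_def)
  have "Ttilde \<Phi> N w M v s a m u = Ttilde \<Phi> N w M v s a (2 * s + 1 - m) u" if u: "u \<notin> E" for u
  proof -
    have P: "u \<in> P n c" if "\<Phi> (u + of_int n - c) = 0" for n c
      unfolding P_def using that by (intro image_eqI[of _ _ "u + of_int n - c"]) (auto simp: Z_def)
    have 1: "\<Phi> (u + of_int n - w j) \<noteq> 0" for n j
      using u P[of n "w j"] by (auto simp: E_def)
    have 2: "\<Phi> (u + of_int n - v k j) \<noteq> 0" for n k j
      using u P[of n "v k j"] by (auto simp: E_def)
    show ?thesis
      unfolding Ttilde_def using assms 1 2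
      by (intro Trect_div_Fnorm_dual) (auto simp: vac_def Qfun_def)
  qed
  then have "{u. Ttilde \<Phi> N w M v s a m u \<noteq> Ttilde \<Phi> N w M v s a (2 * s + 1 - m) u} \<subseteq> E"
    by blast
  with E show "countable {u. Ttilde \<Phi> N w M v s a m u \<noteq> Ttilde \<Phi> N w M v s a (2 * s + 1 - m) u}"
    by (rule countable_subset[rotated])
qed (use Ttilde_meromorphic assms(1) in auto)

end
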